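(* Consider the FlexPD-F iterates described in the context with $\alpha,\beta>0$, integer $T\ge1$, and $U=I-\alpha B$. If $\alpha<1/\rho(B)$, then for any $d,e,g>1$ and every $k\ge0$, \[\|\lambda^{k+1}-\lambda^*\|^2\le \frac{d}{\alpha^2 s(AA')}\Big(\frac{e}{e-1}\rho(U^2)+e\alpha^2L^2\Big)\|x^{k+1,T-1}-x^{k+1,T}\|^2+\frac{d}{(d-1)\alpha^2 s(AA')}\Big(\frac{g}{g-1}\alpha^2\rho\big((\beta A'A-B)^2\big)+g\alpha^2L^2\Big)\|x^{k+1,T}-x^*\|^2.\]
   Context: Setting: $n$ agents are connected by a connected undirected graph with edge set $\mathcal E$, $\epsilon=|\mathcal E|$. For $x\in\mathbb R^n$ let $f(x)=\sum_{i=1}^n f_i(x_i)$, where each $f_i:\mathbb R\to\mathbb R$ is twice differentiable with $m\le f_i''\le L$ for constants $0<m\le L$; $\nabla f(x)=(f_1'(x_1),\dots,f_n'(x_n))'$. $A\in\mathbb R^{\epsilon\times n}$ is the edge–node incidence matrix (null space spanned by the all-ones vector). $B\in\mathbb R^{n\times n}$ is symmetric positive semidefinite with the same null space as $A$, off-diagonal entries nonzero only on edges. $x^*$ is the unique minimizer of $f$ subject to $Ax=0$ and $\lambda^*$ a Lagrange multiplier with $\nabla f(x^* )+A'\lambda^*=0$, $Ax^*=0$, $Bx^*=0$, chosen in the column space of $A$ (orthogonal to the null space of $A'$). FlexPD-F: given $\alpha,\beta>0$, $T\ge1$, $x^0$ arbitrary, $\lambda^0=0$; for $k\ge0$: $x^{k+1,0}=x^k$,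 $x^{k+1,t}=(I-\alpha B)x^{k+1,t-1}-\alpha\nabla f(x^{k+1,t-1})-\alpha A'\lambda^k$ for $t=1,\dots,T$, $x^{k+1}=x^{k+1,T}$, $\lambda^{k+1}=\lambda^k+\beta Ax^{k+1}$. Notation: $\rho(S)$ largest eigenvalue of a symmetric matrix $S$; $s(AA')$ smallest nonzero eigenvalue of $AA'$; $\|\cdot\|$ Euclidean norm. *)

theory Defs
  imports "HOL-Analysis.Analysis"
begin

text \<open>Largest eigenvalue of a (symmetric) square matrix.\<close>
definition max_eig :: "real^'n^'n \<Rightarrow> real" where
  "max_eig S = Max {\<mu>. \<exists>v. v \<noteq> 0 \<and> S *v v = \<mu> *\<^sub>R v}"

text \<open>Smallest nonzero eigenvalue of a (symmetric) square matrix.\<close>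
definition min_nz_eig :: "real^'n^'n \<Rightarrow> real" where
  "min_nz_eig S = Min {\<mu>. \<mu> \<noteq> 0 \<and> (\<exists>v. v \<noteq> 0 \<and> S *v v = \<mu> *\<^sub>R v)}"

text \<open>Edge-node incidence matrix of a simple connected undirected graph:
  each row (edge) has one entry 1, one entry -1 (at the two distinct endpoints)
  and zeros elsewhere; distinct rows are distinct edges; the null space is
  spanned by the all-ones vector (connectedness).\<close>
definition incidence_matrix :: "real^'n^'e \<Rightarrow> bool" where
  "incidence_matrix A \<longleftrightarrow>
     (\<forall>e. \<exists>i j. i \<noteq> j \<and> A$e$i = 1 \<and> A$e$j = -1 \<and> (\<forall>k. k \<noteq> i \<and> k \<noteq> j \<longrightarrow> A$e$k = 0)) \<and>
     (\<forall>e1 e2. e1 \<noteq> e2 \<longrightarrow> A$e1 \<noteq> A$e2 \<and> A$e1 \<noteq> - A$e2) \<and>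
     {x. A *v x = 0} = span {(\<chi> i. 1)}"

text \<open>Gradient of the separable function sum_i f_i(x_i), given the derivatives f_i'.\<close>
definition sep_grad :: "('n \<Rightarrow> real \<Rightarrow> real) \<Rightarrow> real^'n \<Rightarrow> real^'n" where
  "sep_grad f' x = (\<chi> i. f' i (x$i))"

text \<open>Inner loop: x^{k+1,t} computed from x^{k+1,0} = x and lambda^k = lam.\<close>
fun flexpd_inner :: "real \<Rightarrow> real^'n^'n \<Rightarrow> real^'n^'e \<Rightarrow> ('n \<Rightarrow> real \<Rightarrow> real)
      \<Rightarrow> real^'e \<Rightarrow> real^'n \<Rightarrow> nat \<Rightarrow> real^'n" where
  "flexpd_inner \<alpha> B A f' lam x 0 = x"
| "flexpd_inner \<alpha> B A f' lam x (Suc t) =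
     (let y = flexpd_inner \<alpha> B A f' lam x t in
      (mat 1 - \<alpha> *\<^sub>R B) *v y - \<alpha> *\<^sub>R sep_grad f' y - \<alpha> *\<^sub>R (transpose A *v lam))"

text \<open>Outer loop: (x^k, lambda^k), with lambda^0 = 0.\<close>
fun flexpd :: "real \<Rightarrow> real \<Rightarrow> nat \<Rightarrow> real^'n^'n \<Rightarrow> real^'n^'e \<Rightarrow> ('n \<Rightarrow> real \<Rightarrow> real)
      \<Rightarrow> real^'n \<Rightarrow> nat \<Rightarrow> (real^'n) \<times> (real^'e)" where
  "flexpd \<alpha> \<beta> T B A f' x0 0 = (x0, 0)"
| "flexpd \<alpha> \<beta> T B A f' x0 (Suc k) =
     (let (x, lam) = flexpd \<alpha> \<beta> T B A f' x0 k;
          x' = flexpd_inner \<alpha> B A f' lam x T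
      in (x', lam + \<beta> *\<^sub>R (A *v x')))"

end

theory Submission
  imports Defs
begin

text \<open>Write mu = lambda^(k+1) - lambda*. One outer step together with the KKT conditions gives
  alpha A' mu = [U (x^(T-1) - x^T) - alpha (grad f(x^(T-1)) - grad f(x^T))]
              + [alpha C (x^T - x*) - alpha (grad f(x^T) - grad f(x*))]
  with C = beta A'A - B. Since mu stays in the range of A, which is invariant under AA',
  the Rayleigh quotient of AA' there gives s(AA') |mu|^2 <= |A' mu|^2. Young's inequality
  |a + b|^2 <= d |a|^2 + d/(d-1) |b|^2, used with d for the two brackets and with e and g
  inside them, together with |S v|^2 <= rho(S^2) |v|^2 for symmetric S and the
  L-Lipschitz gradient, gives the bound.\<close>

definition eigenvalues :: "real^'n^'n \<Rightarrow> real set" where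
  "eigenvalues S = {\<mu>. \<exists>v. v \<noteq> 0 \<and> S *v v = \<mu> *\<^sub>R v}"

lemma max_eig_eq_Max_eigenvalues: "max_eig S = Max (eigenvalues S)"
  by (simp add: max_eig_def eigenvalues_def)

lemma min_nz_eig_eq_Min_eigenvalues: "min_nz_eig S = Min (eigenvalues S - {0})"
  unfolding min_nz_eig_def eigenvalues_def by (rule arg_cong[where f = Min]) blast

lemma transpose_diff: "transpose (X - Y) = transpose X - transpose (Y :: 'a::ab_group_add^'n^'m)"
  by (simp add: transpose_def vec_eq_iff)

lemma inner_symmetric_matrix_vector:
  fixes S :: "real^'n^'n"
  assumes "transpose S = S"
  shows "x \<bullet> (S *v y) = (S *v x) \<bullet> y"
  by (metis assms dot_lmul_matrix transpose_matrix_vector)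

lemma finite_eigenvalues_symmetric:
  fixes S :: "real^'n^'n"
  assumes S: "transpose S = S"
  shows "finite (eigenvalues S)"
proof -
  define vec_of where "vec_of = (\<lambda>\<mu>. SOME v. v \<noteq> 0 \<and> S *v v = \<mu> *\<^sub>R v)"
  have eigvec: "vec_of \<mu> \<noteq> 0 \<and> S *v vec_of \<mu> = \<mu> *\<^sub>R vec_of \<mu>" if "\<mu> \<in> eigenvalues S" for \<mu>
    using that unfolding eigenvalues_def vec_of_def by (metis (mono_tags, lifting) mem_Collect_eq someI_ex)
  have orth: "vec_of \<mu> \<bullet> vec_of \<nu> = 0"
    if "\<mu> \<in> eigenvalues S" "\<nu> \<in> eigenvalues S" "\<mu> \<noteq> \<nu>" for \<mu> \<nu>
  proof -
    have "\<nu> * (vec_of \<mu> \<bullet> vec_of \<nu>) = vec_of \<mu> \<bullet> (S *v vec_of \<nu>)" using eigvec[OF that(2)] by simp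
    also have "\<dots> = (S *v vec_of \<mu>) \<bullet> vec_of \<nu>" by (rule inner_symmetric_matrix_vector[OF S])
    also have "\<dots> = \<mu> * (vec_of \<mu> \<bullet> vec_of \<nu>)" using eigvec[OF that(1)] by simp
    finally show ?thesis using that(3) by simp
  qed
  have "inj_on vec_of (eigenvalues S)"
    by (rule inj_onI) (metis orth eigvec inner_eq_zero_iff)
  moreover have "independent (vec_of ` eigenvalues S)"
  proof (rule pairwise_orthogonal_independent)
    show "pairwise orthogonal (vec_of ` eigenvalues S)"
      unfolding pairwise_def orthogonal_def using orth by (metis imageE)
    show "0 \<notin> vec_of ` eigenvalues S" using eigvec by auto
  qed
  ultimately show ?thesis using finiteI_independent finite_imageD by blast
qed

lemma linear_coeff_zero_if_quadratic_nonpos: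
  fixes a b :: real
  assumes "\<And>t. a * t + b * t\<^sup>2 \<le> 0"
  shows "a = 0"
proof (rule ccontr)
  assume "a \<noteq> 0"
  define c where "c = \<bar>b\<bar> + 1"
  have "c > 0" "c + b > 0" by (auto simp: c_def)
  then have "a * (a / c) + b * (a / c)\<^sup>2 = a\<^sup>2 * (c + b) / c\<^sup>2"
    by (simp add: field_simps power2_eq_square)
  also have "\<dots> > 0" using \<open>a \<noteq> 0\<close> \<open>c + b > 0\<close> \<open>c > 0\<close> by simp
  finally show False using assms[of "a / c"] by simp
qed

lemma rayleigh_max_attained:
  fixes S :: "real^'n^'n"
  assumes V: "subspace V" and "V \<noteq> {0}"
  obtains v0 where "v0 \<in> V" "norm v0 = 1"
    "\<And>v. v \<in> V \<Longrightarrow> v \<bullet> (S *v v) \<le> v0 \<bullet> (S *v v0) * (norm v)\<^sup>2"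
proof -
  define q where "q = (\<lambda>v. v \<bullet> (S *v v))"
  define K where "K = sphere 0 1 \<inter> V"
  have "compact K" unfolding K_def
    by (intro compact_Int_closed compact_sphere closed_subspace V)
  moreover obtain w where "w \<in> V" "w \<noteq> 0" using \<open>V \<noteq> {0}\<close> subspace_0[OF V] by blast
  then have "(1 / norm w) *\<^sub>R w \<in> K" unfolding K_def using V by (simp add: subspace_scale)
  then have "K \<noteq> {}" by blast
  moreover have "continuous_on K q" unfolding q_def
    by (intro continuous_intros linear_continuous_on matrix_vector_mul_bounded_linear)
  ultimately obtain v0 where "v0 \<in> K" and v0_max: "\<forall>y\<in>K. q y \<le> q v0"
    using continuous_attains_sup by blast
  have "q v \<le> q v0 * (norm v)\<^sup>2" if "v \<in> V" for v
  proof (cases "v = 0")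
    case True then show ?thesis by (simp add: q_def)
  next
    case False
    have "(1 / norm v) *\<^sub>R v \<in> K" unfolding K_def using V that False by (simp add: subspace_scale)
    then have "q ((1 / norm v) *\<^sub>R v) \<le> q v0" using v0_max by auto
    moreover have "q ((1 / norm v) *\<^sub>R v) = q v / (norm v)\<^sup>2"
      unfolding q_def by (simp add: matrix_vector_mult_scaleR power2_eq_square)
    ultimately show ?thesis using False by (simp add: divide_le_eq)
  qed
  then show ?thesis using that \<open>v0 \<in> K\<close> unfolding K_def q_def by auto
qed

lemma rayleigh_max_eigenvector:
  fixes S :: "real^'n^'n"
  assumes S: "transpose S = S" and V: "subspace V" and S_V: "\<And>v. v \<in> V \<Longrightarrow> S *v v \<in> V"
    and "V \<noteq> {0}"
  obtains M v0 where "v0 \<in> V" "v0 \<noteq> 0" "S *v v0 = M *\<^sub>R v0"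
    "\<And>v. v \<in> V \<Longrightarrow> v \<bullet> (S *v v) \<le> M * (norm v)\<^sup>2"
proof -
  define q where "q = (\<lambda>v. v \<bullet> (S *v v))"
  obtain v0 where v0_V: "v0 \<in> V" and norm_v0: "norm v0 = 1"
    and bound: "\<And>v. v \<in> V \<Longrightarrow> q v \<le> q v0 * (norm v)\<^sup>2"
    using rayleigh_max_attained[OF V \<open>V \<noteq> {0}\<close>] unfolding q_def by blast
  define M where "M = q v0"
  text \<open>v0 is an eigenvector: along the residual w the quadratic t \<mapsto> q (v0 + t w) - M |v0 + t w|^2
    is maximal at t = 0, so its linear coefficient 2 |w|^2 vanishes.\<close>
  define w where "w = S *v v0 - M *\<^sub>R v0"
  have w_V: "w \<in> V" unfolding w_def using V S_V v0_V by (simp add: subspace_diff subspace_scale)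
  have "2 * (w \<bullet> w) * t + (q w - M * (norm w)\<^sup>2) * t\<^sup>2 \<le> 0" for t
  proof -
    have "v0 + t *\<^sub>R w \<in> V" using V v0_V w_V by (simp add: subspace_add subspace_scale)
    then have "q (v0 + t *\<^sub>R w) - M * (norm (v0 + t *\<^sub>R w))\<^sup>2 \<le> 0"
      using bound unfolding M_def by force
    moreover have "q (v0 + t *\<^sub>R w) = q v0 + 2 * t * ((S *v v0) \<bullet> w) + t\<^sup>2 * q w"
      unfolding q_def using inner_symmetric_matrix_vector[OF S, of v0 w]
      by (simp add: matrix_vector_mult_add_rdistrib algebra_simps inner_add_left inner_add_right
          matrix_vector_mult_scaleR power2_eq_square inner_commute)
    moreover have "(norm (v0 + t *\<^sub>R w))\<^sup>2 = 1 + 2 * t * (v0 \<bullet> w) + t\<^sup>2 * (norm w)\<^sup>2"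
      using norm_v0 unfolding power2_norm_eq_inner norm_eq_1
      by (simp add: inner_add_left inner_add_right algebra_simps power2_eq_square inner_commute)
    moreover have "(S *v v0) \<bullet> w - M * (v0 \<bullet> w) = w \<bullet> w"
      unfolding w_def by (simp add: inner_diff_left inner_diff_right inner_commute algebra_simps)
    ultimately show ?thesis unfolding M_def by (simp add: algebra_simps power2_eq_square)
  qed
  then have "2 * (w \<bullet> w) = 0" by (rule linear_coeff_zero_if_quadratic_nonpos)
  then have "S *v v0 = M *\<^sub>R v0" unfolding w_def by simp
  moreover have "v0 \<noteq> 0" using norm_v0 by auto
  ultimately show ?thesis using that v0_V bound unfolding q_def M_def by blast
qed

lemma rayleigh_min_eigenvector:
  fixes S :: "real^'n^'n"
  assumes S: "transpose S = S" and V: "subspace V" and S_V: "\<And>v. v \<in> V \<Longrightarrow> S *v v \<in> V"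
    and "V \<noteq> {0}"
  obtains M v0 where "v0 \<in> V" "v0 \<noteq> 0" "S *v v0 = M *\<^sub>R v0"
    "\<And>v. v \<in> V \<Longrightarrow> M * (norm v)\<^sup>2 \<le> v \<bullet> (S *v v)"
proof -
  have neg: "(- S) *v v = - (S *v v)" for v
    by (simp add: matrix_vector_mult_def sum_negf vec_eq_iff)
  have "transpose (- S) = - S" using S by (metis transpose_scalar scaleR_minus1_left)
  moreover have "(- S) *v v \<in> V" if "v \<in> V" for v
    using S_V[OF that] V neg by (simp add: subspace_neg)
  ultimately obtain M v0 where "v0 \<in> V" "v0 \<noteq> 0" and eig: "(- S) *v v0 = M *\<^sub>R v0"
      and bound: "\<And>v. v \<in> V \<Longrightarrow> v \<bullet> ((- S) *v v) \<le> M * (norm v)\<^sup>2"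
    using rayleigh_max_eigenvector[OF _ V _ \<open>V \<noteq> {0}\<close>] by metis
  show ?thesis
  proof (rule that[of v0 "- M"])
    have "S *v v0 = - ((- S) *v v0)" by (simp add: neg)
    then show "S *v v0 = (- M) *\<^sub>R v0" using eig by simp
    show "- M * (norm v)\<^sup>2 \<le> v \<bullet> (S *v v)" if "v \<in> V" for v
      using bound[OF that] neg by simp
  qed fact+
qed

lemma quadratic_form_le_max_eig:
  fixes S :: "real^'n^'n"
  assumes S: "transpose S = S"
  shows "x \<bullet> (S *v x) \<le> max_eig S * (norm x)\<^sup>2"
proof -
  have "(UNIV :: (real^'n) set) \<noteq> {0}" by (metis axis_eq_0_iff one_neq_zero UNIV_I singletonD)
  then obtain M v0 where "v0 \<noteq> 0" "S *v v0 = M *\<^sub>R v0"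
      and M_bound: "\<And>v. v \<bullet> (S *v v) \<le> M * (norm v)\<^sup>2"
    using rayleigh_max_eigenvector[OF S subspace_UNIV] by (metis UNIV_I)
  then have "M \<in> eigenvalues S" unfolding eigenvalues_def by auto
  then have "M \<le> max_eig S"
    unfolding max_eig_eq_Max_eigenvalues using finite_eigenvalues_symmetric[OF S] by simp
  then show ?thesis using M_bound[of x] by (meson mult_right_mono zero_le_power2 order_trans)
qed

lemma norm_symmetric_matrix_vector_le:
  fixes S :: "real^'n^'n"
  assumes S: "transpose S = S"
  shows "(norm (S *v x))\<^sup>2 \<le> max_eig (S ** S) * (norm x)\<^sup>2"
proof -
  have "(norm (S *v x))\<^sup>2 = x \<bullet> ((S ** S) *v x)"
    unfolding power2_norm_eq_inner matrix_vector_mul_assoc[symmetric]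
    using inner_symmetric_matrix_vector[OF S] by metis
  moreover have "transpose (S ** S) = S ** S" by (simp add: matrix_transpose_mul S)
  ultimately show ?thesis using quadratic_form_le_max_eig by metis
qed

lemma inner_gram_matrix_vector:
  fixes A :: "real^'n^'e"
  shows "v \<bullet> ((A ** transpose A) *v v) = (norm (transpose A *v v))\<^sup>2"
  unfolding power2_norm_eq_inner matrix_vector_mul_assoc[symmetric]
  using dot_lmul_matrix[of v A "transpose A *v v"] by simp

lemma gram_eigenvalues_nonneg:
  fixes A :: "real^'n^'e"
  assumes "\<mu> \<in> eigenvalues (A ** transpose A)"
  shows "0 \<le> \<mu>"
proof -
  obtain v where "v \<noteq> 0" "(A ** transpose A) *v v = \<mu> *\<^sub>R v"
    using assms unfolding eigenvalues_def by auto
  then have "\<mu> * (v \<bullet> v) = (norm (transpose A *v v))\<^sup>2"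
    using inner_gram_matrix_vector[of v A] by simp
  then have "0 \<le> \<mu> * (v \<bullet> v)" by simp
  moreover have "0 < v \<bullet> v" using \<open>v \<noteq> 0\<close> by simp
  ultimately show ?thesis by (simp add: zero_le_mult_iff)
qed

lemma gram_eigenvalue_on_range_nonzero:
  fixes A :: "real^'n^'e"
  assumes "v \<in> range ((*v) A)" "v \<noteq> 0" "(A ** transpose A) *v v = M *\<^sub>R v"
  shows "M \<noteq> 0"
proof
  assume "M = 0"
  obtain y where v: "v = A *v y" using assms(1) by auto
  have "(norm (transpose A *v v))\<^sup>2 = 0"
    using inner_gram_matrix_vector[of v A] assms(3) \<open>M = 0\<close> by simp
  then have "transpose A *v (A *v y) = 0" using v by simp
  then have "(A *v y) \<bullet> (A *v y) = 0"
    using dot_lmul_matrix[of y "transpose A" "A *v y"] by simp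
  then show False using assms(2) v by simp
qed

lemma min_nz_eig_gram:
  fixes A :: "real^'n^'e"
  assumes "A \<noteq> 0"
  shows min_nz_eig_gram_pos: "0 < min_nz_eig (A ** transpose A)"
    and min_nz_eig_gram_le: "\<mu> \<in> range ((*v) A) \<Longrightarrow>
      min_nz_eig (A ** transpose A) * (norm \<mu>)\<^sup>2 \<le> (norm (transpose A *v \<mu>))\<^sup>2"
proof -
  define P where "P = A ** transpose A"
  define V where "V = range ((*v) A)"
  have "transpose P = P" unfolding P_def by (simp add: matrix_transpose_mul)
  moreover have "subspace V" unfolding V_def
    by (intro linear_subspace_image subspace_UNIV matrix_vector_mul_linear)
  moreover have "P *v v \<in> V" if "v \<in> V" for v
    using that unfolding P_def V_def by (auto simp: matrix_vector_mul_assoc[symmetric])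
  moreover have "V \<noteq> {0}"
  proof
    assume "V = {0}"
    then have "A *v x = 0 *v x" for x unfolding V_def by auto
    then show False using assms matrix_eq by blast
  qed
  ultimately obtain M v0 where "v0 \<in> V" "v0 \<noteq> 0" "P *v v0 = M *\<^sub>R v0"
      and M_bound: "\<And>v. v \<in> V \<Longrightarrow> M * (norm v)\<^sup>2 \<le> v \<bullet> (P *v v)"
    by (rule rayleigh_min_eigenvector) blast+
  then have "M \<noteq> 0" using gram_eigenvalue_on_range_nonzero unfolding V_def P_def by blast
  then have M_eig: "M \<in> eigenvalues P - {0}"
    unfolding eigenvalues_def using \<open>v0 \<noteq> 0\<close> \<open>P *v v0 = M *\<^sub>R v0\<close> by auto
  have fin: "finite (eigenvalues P - {0})"
    using finite_eigenvalues_symmetric[OF \<open>transpose P = P\<close>] by simp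
  have pos: "0 < \<mu>" if "\<mu> \<in> eigenvalues P - {0}" for \<mu>
    using that gram_eigenvalues_nonneg[of \<mu> A] unfolding P_def by force
  have min_eq: "min_nz_eig P = Min (eigenvalues P - {0})" by (rule min_nz_eig_eq_Min_eigenvalues)
  show "0 < min_nz_eig (A ** transpose A)"
    using Min_in[OF fin] M_eig pos unfolding min_eq[unfolded P_def] P_def by blast
  show "min_nz_eig (A ** transpose A) * (norm \<mu>)\<^sup>2 \<le> (norm (transpose A *v \<mu>))\<^sup>2"
    if "\<mu> \<in> range ((*v) A)"
  proof -
    have "min_nz_eig P \<le> M" using Min_le[OF fin M_eig] min_eq by simp
    then have "min_nz_eig P * (norm \<mu>)\<^sup>2 \<le> M * (norm \<mu>)\<^sup>2" by (simp add: mult_right_mono)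
    also have "\<dots> \<le> (norm (transpose A *v \<mu>))\<^sup>2"
      using M_bound[of \<mu>] that inner_gram_matrix_vector[of \<mu> A] unfolding V_def P_def by simp
    finally show ?thesis unfolding P_def .
  qed
qed

lemma power2_add_le_weighted:
  fixes x y d :: real
  assumes d: "1 < d"
  shows "(x + y)\<^sup>2 \<le> d * x\<^sup>2 + d / (d - 1) * y\<^sup>2"
proof -
  have "(d - 1) * (d / (d - 1) * y\<^sup>2) = d * y\<^sup>2" using d by simp
  then have "(d - 1) * (d * x\<^sup>2 + d / (d - 1) * y\<^sup>2) - (d - 1) * (x + y)\<^sup>2 = ((d - 1) * x - y)\<^sup>2"
    unfolding distrib_left by (simp add: power2_eq_square algebra_simps)
  then have "(d - 1) * (x + y)\<^sup>2 \<le> (d - 1) * (d * x\<^sup>2 + d / (d - 1) * y\<^sup>2)"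
    by (metis diff_ge_0_iff_ge zero_le_power2)
  then show ?thesis using d by simp
qed

lemma norm_add_power2_le_weighted:
  fixes a b :: "'a::real_normed_vector"
  assumes "1 < d"
  shows "(norm (a + b))\<^sup>2 \<le> d * (norm a)\<^sup>2 + d / (d - 1) * (norm b)\<^sup>2"
proof -
  have "(norm (a + b))\<^sup>2 \<le> (norm a + norm b)\<^sup>2"
    by (simp add: norm_triangle_ineq power_mono)
  also have "\<dots> \<le> d * (norm a)\<^sup>2 + d / (d - 1) * (norm b)\<^sup>2"
    by (rule power2_add_le_weighted[OF assms])
  finally show ?thesis .
qed

lemma abs_diff_le_of_derivative_bound:
  assumes "\<And>y. (h has_real_derivative h' y) (at y)" and "\<And>y. \<bar>h' y\<bar> \<le> L"
  shows "\<bar>h b - h a\<bar> \<le> L * \<bar>b - a\<bar>"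
proof -
  have le: "\<bar>h b - h a\<bar> \<le> L * \<bar>b - a\<bar>" if "a < b" for a b
  proof -
    obtain z where "h b - h a = (b - a) * h' z"
      using MVT2[OF \<open>a < b\<close>, of h h'] assms(1) by blast
    then show ?thesis using assms(2)[of z] \<open>a < b\<close> by (simp add: abs_mult mult_right_mono mult.commute)
  qed
  consider "a < b" | "a = b" | "b < a" by linarith
  then show ?thesis using le[of a b] le[of b a] by cases (auto simp: abs_minus_commute)
qed

lemma sep_grad_lipschitz:
  assumes "\<And>i y. (f' i has_real_derivative f'' i y) (at y)" and "\<And>i y. \<bar>f'' i y\<bar> \<le> L"
  shows "norm (sep_grad f' x - sep_grad f' y) \<le> L * norm (x - y)"
proof (rule power2_le_imp_le)
  have "L \<ge> 0" using assms(2) by (meson abs_ge_zero order_trans)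
  then show "0 \<le> L * norm (x - y)" by simp
  have "(f' i (x$i) - f' i (y$i))\<^sup>2 \<le> (L * (x$i - y$i))\<^sup>2" for i
  proof -
    have "\<bar>f' i (x$i) - f' i (y$i)\<bar> \<le> L * \<bar>x$i - y$i\<bar>"
      by (rule abs_diff_le_of_derivative_bound[where h' = "f'' i"]) (fact assms)+
    then have "\<bar>f' i (x$i) - f' i (y$i)\<bar>\<^sup>2 \<le> (L * \<bar>x$i - y$i\<bar>)\<^sup>2"
      by (intro power_mono) auto
    then show ?thesis by (simp add: power_mult_distrib)
  qed
  then have "(\<Sum>i\<in>UNIV. (f' i (x$i) - f' i (y$i))\<^sup>2) \<le> (\<Sum>i\<in>UNIV. L\<^sup>2 * (x$i - y$i)\<^sup>2)"
    by (intro sum_mono) (simp add: power_mult_distrib)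
  then show "(norm (sep_grad f' x - sep_grad f' y))\<^sup>2 \<le> (L * norm (x - y))\<^sup>2"
    unfolding power_mult_distrib power2_norm_eq_inner inner_vec_def sep_grad_def
    by (simp add: power2_eq_square sum_distrib_left)
qed

lemma norm_symmetric_step_minus_grad_diff_le:
  fixes S :: "real^'n^'n"
  assumes S: "transpose S = S"
    and f'': "\<And>i y. (f' i has_real_derivative f'' i y) (at y)" "\<And>i y. \<bar>f'' i y\<bar> \<le> L"
    and e: "1 < e"
  shows "(norm (c *\<^sub>R (S *v (x - y)) - \<alpha> *\<^sub>R (sep_grad f' x - sep_grad f' y)))\<^sup>2
    \<le> (e / (e - 1) * c\<^sup>2 * max_eig (S ** S) + e * \<alpha>\<^sup>2 * L\<^sup>2) * (norm (x - y))\<^sup>2"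
proof -
  have "norm (sep_grad f' x - sep_grad f' y) \<le> L * norm (x - y)"
    by (rule sep_grad_lipschitz) (fact f'')+
  then have "(norm (sep_grad f' x - sep_grad f' y))\<^sup>2 \<le> (L * norm (x - y))\<^sup>2"
    by (intro power_mono) simp_all
  then have grad: "(norm (\<alpha> *\<^sub>R (sep_grad f' x - sep_grad f' y)))\<^sup>2 \<le> \<alpha>\<^sup>2 * L\<^sup>2 * (norm (x - y))\<^sup>2"
    by (simp add: power_mult_distrib mult_left_mono mult.assoc)
  have lin: "(norm (c *\<^sub>R (S *v (x - y))))\<^sup>2 \<le> c\<^sup>2 * max_eig (S ** S) * (norm (x - y))\<^sup>2"
    using norm_symmetric_matrix_vector_le[OF S, of "x - y"]
    by (simp add: power_mult_distrib mult_left_mono mult.assoc)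
  have "(norm (- (\<alpha> *\<^sub>R (sep_grad f' x - sep_grad f' y)) + c *\<^sub>R (S *v (x - y))))\<^sup>2
      \<le> e * (norm (\<alpha> *\<^sub>R (sep_grad f' x - sep_grad f' y)))\<^sup>2 + e / (e - 1) * (norm (c *\<^sub>R (S *v (x - y))))\<^sup>2"
    using norm_add_power2_le_weighted[OF e] by (metis norm_minus_cancel)
  also have "\<dots> \<le> e * (\<alpha>\<^sup>2 * L\<^sup>2 * (norm (x - y))\<^sup>2) + e / (e - 1) * (c\<^sup>2 * max_eig (S ** S) * (norm (x - y))\<^sup>2)"
    using e grad lin by (intro add_mono mult_left_mono) simp_all
  finally show ?thesis by (simp add: algebra_simps)
qed

lemma flexpd_multiplier_in_range: "snd (flexpd \<alpha> \<beta> T B A f' x0 k) \<in> range ((*v) A)"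
proof (induction k)
  case 0
  show ?case by (auto intro: range_eqI[of _ _ 0])
next
  case (Suc k)
  obtain x lam where P: "flexpd \<alpha> \<beta> T B A f' x0 k = (x, lam)" by fastforce
  with Suc obtain y where "lam = A *v y" by auto
  then have "snd (flexpd \<alpha> \<beta> T B A f' x0 (Suc k)) = A *v (y + \<beta> *\<^sub>R flexpd_inner \<alpha> B A f' lam x T)"
    using P by (simp add: Let_def algebra_simps)
  then show ?case by simp
qed

lemma dual_error_decomposition:
  fixes A :: "real^'n^'e" and B :: "real^'n^'n" and G :: "real^'n \<Rightarrow> real^'n"
  assumes step: "x' = (mat 1 - \<alpha> *\<^sub>R B) *v x - \<alpha> *\<^sub>R G x - \<alpha> *\<^sub>R (transpose A *v lam)"
    and kkt: "G xs + transpose A *v ls = 0" and "A *v xs = 0" and "B *v xs = 0"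
  shows "\<alpha> *\<^sub>R (transpose A *v (lam + \<beta> *\<^sub>R (A *v x') - ls))
    = ((mat 1 - \<alpha> *\<^sub>R B) *v (x - x') - \<alpha> *\<^sub>R (G x - G x'))
      + (\<alpha> *\<^sub>R ((\<beta> *\<^sub>R (transpose A ** A) - B) *v (x' - xs)) - \<alpha> *\<^sub>R (G x' - G xs))"
proof -
  have U: "(mat 1 - \<alpha> *\<^sub>R B) *v v = v - \<alpha> *\<^sub>R (B *v v)" for v
    by (simp add: matrix_vector_mult_diff_rdistrib flip: scaleR_matrix_vector_assoc)
  have C: "(\<beta> *\<^sub>R (transpose A ** A) - B) *v v = \<beta> *\<^sub>R (transpose A *v (A *v v)) - B *v v" for v
    by (simp only: matrix_vector_mult_diff_rdistrib matrix_vector_mul_assoc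
        flip: scaleR_matrix_vector_assoc)
  have "transpose A *v ls = - G xs" using kkt by (simp add: eq_neg_iff_add_eq_0 add.commute)
  then show ?thesis
    unfolding C U step using assms(3,4)
    by (simp add: algebra_simps)
qed

lemma norm_multiplier_le_split:
  fixes A :: "real^'n^'e"
  assumes "A \<noteq> 0" and "\<mu> \<in> range ((*v) A)" and split: "\<alpha> *\<^sub>R (transpose A *v \<mu>) = a + b"
    and "\<alpha> \<noteq> 0" and d: "1 < d"
  shows "(norm \<mu>)\<^sup>2 \<le> d / (\<alpha>\<^sup>2 * min_nz_eig (A ** transpose A)) * (norm a)\<^sup>2
    + d / ((d - 1) * \<alpha>\<^sup>2 * min_nz_eig (A ** transpose A)) * (norm b)\<^sup>2"
proof -
  define s where "s = min_nz_eig (A ** transpose A)"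
  have "\<alpha>\<^sup>2 * s * (norm \<mu>)\<^sup>2 \<le> \<alpha>\<^sup>2 * (norm (transpose A *v \<mu>))\<^sup>2"
    using min_nz_eig_gram_le[OF assms(1,2)] by (simp add: s_def mult.assoc mult_left_mono)
  also have "\<dots> = (norm (a + b))\<^sup>2"
    unfolding split[symmetric] by (simp add: power_mult_distrib)
  also have "\<dots> \<le> d * (norm a)\<^sup>2 + d / (d - 1) * (norm b)\<^sup>2"
    by (rule norm_add_power2_le_weighted[OF d])
  finally have "\<alpha>\<^sup>2 * s * (norm \<mu>)\<^sup>2 \<le> \<dots>" .
  moreover have "0 < \<alpha>\<^sup>2 * s" using \<open>\<alpha> \<noteq> 0\<close> min_nz_eig_gram_pos[OF \<open>A \<noteq> 0\<close>] s_def by simp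
  ultimately have "(norm \<mu>)\<^sup>2 \<le> (d * (norm a)\<^sup>2 + d / (d - 1) * (norm b)\<^sup>2) / (\<alpha>\<^sup>2 * s)"
    by (simp add: pos_le_divide_eq mult.commute)
  also have "\<dots> = d / (\<alpha>\<^sup>2 * s) * (norm a)\<^sup>2 + d / ((d - 1) * \<alpha>\<^sup>2 * s) * (norm b)\<^sup>2"
    by (simp add: add_divide_distrib mult.assoc)
  finally show ?thesis unfolding s_def .
qed

lemma multiplier_error_bound:
  fixes A :: "real^'n^'e" and B :: "real^'n^'n" and f' f'' :: "'n \<Rightarrow> real \<Rightarrow> real"
  assumes "A \<noteq> 0" and B_sym: "transpose B = B"
    and f'_deriv: "\<And>i y. (f' i has_real_derivative f'' i y) (at y)"
    and f''_bound: "\<And>i y. \<bar>f'' i y\<bar> \<le> L"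
    and step: "x' = (mat 1 - \<alpha> *\<^sub>R B) *v x - \<alpha> *\<^sub>R sep_grad f' x - \<alpha> *\<^sub>R (transpose A *v lam)"
    and kkt: "sep_grad f' xs + transpose A *v ls = 0" and "A *v xs = 0" and "B *v xs = 0"
    and lam_range: "lam \<in> range ((*v) A)" and ls_range: "ls \<in> range ((*v) A)"
    and "\<alpha> \<noteq> 0" and d: "1 < d" and e: "1 < e" and g: "1 < g"
  shows "(norm (lam + \<beta> *\<^sub>R (A *v x') - ls))\<^sup>2
    \<le> d / (\<alpha>\<^sup>2 * min_nz_eig (A ** transpose A))
        * (e / (e - 1) * max_eig ((mat 1 - \<alpha> *\<^sub>R B) ** (mat 1 - \<alpha> *\<^sub>R B)) + e * \<alpha>\<^sup>2 * L\<^sup>2)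
        * (norm (x - x'))\<^sup>2
      + d / ((d - 1) * \<alpha>\<^sup>2 * min_nz_eig (A ** transpose A))
        * (g / (g - 1) * \<alpha>\<^sup>2 * max_eig ((\<beta> *\<^sub>R (transpose A ** A) - B) ** (\<beta> *\<^sub>R (transpose A ** A) - B))
           + g * \<alpha>\<^sup>2 * L\<^sup>2)
        * (norm (x' - xs))\<^sup>2"
proof -
  define U where "U = mat 1 - \<alpha> *\<^sub>R B"
  define C where "C = \<beta> *\<^sub>R (transpose A ** A) - B"
  define s where "s = min_nz_eig (A ** transpose A)"
  define a where "a = 1 *\<^sub>R (U *v (x - x')) - \<alpha> *\<^sub>R (sep_grad f' x - sep_grad f' x')"
  define b where "b = \<alpha> *\<^sub>R (C *v (x' - xs)) - \<alpha> *\<^sub>R (sep_grad f' x' - sep_grad f' xs)"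
  have "transpose U = U" "transpose C = C"
    unfolding U_def C_def transpose_diff transpose_scalar B_sym by (simp_all add: matrix_transpose_mul)
  have "(norm a)\<^sup>2 \<le> (e / (e - 1) * 1\<^sup>2 * max_eig (U ** U) + e * \<alpha>\<^sup>2 * L\<^sup>2) * (norm (x - x'))\<^sup>2"
    unfolding a_def
    by (rule norm_symmetric_step_minus_grad_diff_le) (fact \<open>transpose U = U\<close> f'_deriv f''_bound e)+
  then have a_bound: "(norm a)\<^sup>2 \<le> (e / (e - 1) * max_eig (U ** U) + e * \<alpha>\<^sup>2 * L\<^sup>2) * (norm (x - x'))\<^sup>2"
    by simp
  have b_bound: "(norm b)\<^sup>2 \<le> (g / (g - 1) * \<alpha>\<^sup>2 * max_eig (C ** C) + g * \<alpha>\<^sup>2 * L\<^sup>2) * (norm (x' - xs))\<^sup>2"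
    unfolding b_def
    by (rule norm_symmetric_step_minus_grad_diff_le) (fact \<open>transpose C = C\<close> f'_deriv f''_bound g)+
  have split: "\<alpha> *\<^sub>R (transpose A *v (lam + \<beta> *\<^sub>R (A *v x') - ls)) = a + b"
    unfolding a_def b_def U_def C_def scaleR_one
    by (rule dual_error_decomposition[OF step kkt]) fact+
  obtain y z where "lam = A *v y" "ls = A *v z" using lam_range ls_range by auto
  then have "lam + \<beta> *\<^sub>R (A *v x') - ls = A *v (y + \<beta> *\<^sub>R x' - z)"
    by (simp add: algebra_simps)
  then have "lam + \<beta> *\<^sub>R (A *v x') - ls \<in> range ((*v) A)" by simp
  then have "(norm (lam + \<beta> *\<^sub>R (A *v x') - ls))\<^sup>2
      \<le> d / (\<alpha>\<^sup>2 * s) * (norm a)\<^sup>2 + d / ((d - 1) * \<alpha>\<^sup>2 * s) * (norm b)\<^sup>2"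
    unfolding s_def by (rule norm_multiplier_le_split[OF \<open>A \<noteq> 0\<close> _ split \<open>\<alpha> \<noteq> 0\<close> d])
  also have "\<dots> \<le> d / (\<alpha>\<^sup>2 * s) * ((e / (e - 1) * max_eig (U ** U) + e * \<alpha>\<^sup>2 * L\<^sup>2) * (norm (x - x'))\<^sup>2)
      + d / ((d - 1) * \<alpha>\<^sup>2 * s) * ((g / (g - 1) * \<alpha>\<^sup>2 * max_eig (C ** C) + g * \<alpha>\<^sup>2 * L\<^sup>2) * (norm (x' - xs))\<^sup>2)"
    using a_bound b_bound d min_nz_eig_gram_pos[OF \<open>A \<noteq> 0\<close>] unfolding s_def[symmetric]
    by (intro add_mono mult_left_mono) simp_all
  finally show ?thesis unfolding U_def C_def s_def by (simp only: mult.assoc)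
qed

theorem lemma3p5:
  fixes A :: "real^'n^'e" and B :: "real^'n^'n"
    and f f' f'' :: "'n \<Rightarrow> real \<Rightarrow> real"
    and m L \<alpha> \<beta> d e g :: real and T k :: nat
    and x0 xs :: "real^'n" and ls :: "real^'e"
  assumes A: "incidence_matrix A"
    and B_sym: "transpose B = B"
    and B_psd: "\<forall>x. 0 \<le> x \<bullet> (B *v x)"
    and B_null: "{x. B *v x = 0} = {x. A *v x = 0}"
    and B_edges: "\<forall>i j. i \<noteq> j \<and> B$i$j \<noteq> 0 \<longrightarrow> (\<exists>ed. A$ed$i \<noteq> 0 \<and> A$ed$j \<noteq> 0)"
    and f_d1: "\<forall>i y. (f i has_real_derivative f' i y) (at y)"
    and f_d2: "\<forall>i y. (f' i has_real_derivative f'' i y) (at y)"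
    and m_pos: "0 < m" and mL: "m \<le> L"
    and f_bounds: "\<forall>i y. m \<le> f'' i y \<and> f'' i y \<le> L"
    and xs_feas: "A *v xs = 0"
    and xs_min: "\<forall>x. A *v x = 0 \<longrightarrow> (\<Sum>i\<in>UNIV. f i (xs$i)) \<le> (\<Sum>i\<in>UNIV. f i (x$i))"
    and ls_kkt: "sep_grad f' xs + transpose A *v ls = 0"
    and ls_range: "ls \<in> range (\<lambda>x. A *v x)"
    and \<alpha>_pos: "0 < \<alpha>" and \<beta>_pos: "0 < \<beta>" and T: "1 \<le> T"
    and \<alpha>_small: "\<alpha> < 1 / max_eig B"
    and d: "1 < d" and e: "1 < e" and g: "1 < g"
  shows
    "(let U = mat 1 - \<alpha> *\<^sub>R B;
          (xk, lk) = flexpd \<alpha> \<beta> T B A f' x0 k;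
          lk1 = snd (flexpd \<alpha> \<beta> T B A f' x0 (Suc k));
          xT1 = flexpd_inner \<alpha> B A f' lk xk (T - 1);
          xT = flexpd_inner \<alpha> B A f' lk xk T;
          s = min_nz_eig (A ** transpose A);
          C = \<beta> *\<^sub>R (transpose A ** A) - B
      in (norm (lk1 - ls))\<^sup>2
         \<le> d / (\<alpha>\<^sup>2 * s) * (e / (e - 1) * max_eig (U ** U) + e * \<alpha>\<^sup>2 * L\<^sup>2)
             * (norm (xT1 - xT))\<^sup>2
           + d / ((d - 1) * \<alpha>\<^sup>2 * s) * (g / (g - 1) * \<alpha>\<^sup>2 * max_eig (C ** C) + g * \<alpha>\<^sup>2 * L\<^sup>2)
             * (norm (xT - xs))\<^sup>2)"
proof -
  txt \<open>Only the symmetry of B, B x* = 0, the KKT pair and the bound on f'' enter the estimate.\<close>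
  obtain xk lk where flexpd_k: "flexpd \<alpha> \<beta> T B A f' x0 k = (xk, lk)" by fastforce
  define xT1 where "xT1 = flexpd_inner \<alpha> B A f' lk xk (T - 1)"
  define xT where "xT = flexpd_inner \<alpha> B A f' lk xk T"
  have lk1: "snd (flexpd \<alpha> \<beta> T B A f' x0 (Suc k)) = lk + \<beta> *\<^sub>R (A *v xT)"
    using flexpd_k by (simp add: xT_def Let_def)
  have step: "xT = (mat 1 - \<alpha> *\<^sub>R B) *v xT1 - \<alpha> *\<^sub>R sep_grad f' xT1 - \<alpha> *\<^sub>R (transpose A *v lk)"
    using T unfolding xT_def xT1_def by (cases T) (simp_all add: Let_def)
  have "A \<noteq> 0" using A unfolding incidence_matrix_def by force
  have "B *v xs = 0" using B_null xs_feas by blast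
  have "lk \<in> range ((*v) A)" using flexpd_multiplier_in_range[of \<alpha> \<beta> T B A f' x0 k] flexpd_k by simp
  have f''_bound: "\<bar>f'' i y\<bar> \<le> L" for i y
    using f_bounds[rule_format, of i y] m_pos by (simp add: abs_le_iff)
  show ?thesis
    unfolding Let_def flexpd_k prod.case xT_def[symmetric] xT1_def[symmetric] lk1
    using \<alpha>_pos by (intro multiplier_error_bound[OF \<open>A \<noteq> 0\<close> B_sym f_d2[rule_format] f''_bound step ls_kkt
        xs_feas \<open>B *v xs = 0\<close> \<open>lk \<in> range ((*v) A)\<close> ls_range _ d e g]) simp
qed

end
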